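(* For any modal formula $A$, the following are equivalent: (1) $\mathsf{CND}\vdash A$. (2) $A$ is valid in all closure models satisfying the conditions $(\mathsf{N})$, $(\mathsf{C})$, and $(\mathsf{D})$. (3) $A$ is valid in all primitive recursively presented closure models satisfying the conditions $(\mathsf{N})$, $(\mathsf{C})$, and $(\mathsf{D})$.
   Context: Modal formulas are built from propositional variables $p_0,p_1,\ldots$ and $\bot$ by $\neg,\land,\lor,\to,\Box$; $\mathrm{MF}$ is the set of all modal formulas. A modal logic is a set $L\subseteq\mathrm{MF}$ containing all classical tautologies and closed under Modus Ponens and uniform substitution; $L\vdash A$ means $A\in L$. $\mathsf{CND}$ is the smallest modal logic closed under the necessitation rule (from $A$ infer $\Box A$) and containing all instances of the schemes $\mathsf{C}$: $\Box A\land\Box B\to\Box(A\land B)$ and $\mathsf{D}$: $\neg(\Box A\land\Box\neg A)$. A closure operator is a map $\mathrm{cl}:\mathcal{P}(\mathrm{MF})\to\mathcal{P}(\mathrm{MF})$ with $X\subseteq\mathrm{cl}(X)$; $X\subseteq Y\Rightarrow\mathrm{cl}(X)\subseteq\mathrm{cl}(Y)$; $\mathrm{cl}(\mathrm{cl}(X))=\mathrm{cl}(X)$. A closure model $\mathcal{M}=(W,G,\mathrm{cl},\Vdash)$ consists of a non-empty set $W$, a map $G:W\to\mathcal{P}(\mathrm{MF})$, a closure operator $\mathrm{cl}$, and a relation $\Vdash$ between $W$ and $\mathrm{MF}$ obeying the usual pointwise Boolean clauses for $\bot,\neg,\land,\lor,\to$, and $x\Vdash\Box A\iff A\in\mathrm{cl}(G(x))$.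 $A$ is valid in $\mathcal{M}$ ($\mathcal{M}\models A$) if $x\Vdash A$ for all $x\in W$. $\mathcal{M}$ is primitive recursively presented if the relations $x\in W$, $x\Vdash p$ (for propositional variables $p$), and $B\in\mathrm{cl}(G(x))$ are primitive recursive (worlds and formulas being coded by natural numbers). $\mathcal{M}$ satisfies: $(\mathsf{N})$ if for all $x\in W$, $A\in\mathrm{MF}$: $\mathcal{M}\models A$ implies $A\in\mathrm{cl}(G(x))$; $(\mathsf{C})$ if for all $x\in W$, $A,B\in\mathrm{MF}$: $A,B\in\mathrm{cl}(G(x))$ implies $A\land B\in\mathrm{cl}(G(x))$; $(\mathsf{D})$ if for all $x\in W$, $A\in\mathrm{MF}$: $A\in\mathrm{cl}(G(x))$ implies $\neg A\notin\mathrm{cl}(G(x))$. *)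

theory Defs
  imports Main "HOL-Library.Nat_Bijection"
begin

datatype fm =
    Var nat
  | Bot
  | Neg fm
  | And fm fm
  | Or fm fm
  | Imp fm fm
  | Box fm

primrec subst :: "(nat \<Rightarrow> fm) \<Rightarrow> fm \<Rightarrow> fm" where
  "subst s (Var n) = s n"
| "subst s Bot = Bot"
| "subst s (Neg A) = Neg (subst s A)"
| "subst s (And A B) = And (subst s A) (subst s B)"
| "subst s (Or A B) = Or (subst s A) (subst s B)"
| "subst s (Imp A B) = Imp (subst s A) (subst s B)"
| "subst s (Box A) = Box (subst s A)"

text \<open>Boxed formulas are treated as atoms, so a tautology here is a substitution instance of a
  tautology without boxes. As modal logics are closed under substitution, it makes no
  difference whether they are required to contain all of these or only the box-free ones.\<close>

primrec truth :: "(fm \<Rightarrow> bool) \<Rightarrow> fm \<Rightarrow> bool" where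
  "truth v (Var n) = v (Var n)"
| "truth v Bot = False"
| "truth v (Neg A) = (\<not> truth v A)"
| "truth v (And A B) = (truth v A \<and> truth v B)"
| "truth v (Or A B) = (truth v A \<or> truth v B)"
| "truth v (Imp A B) = (truth v A \<longrightarrow> truth v B)"
| "truth v (Box A) = v (Box A)"

definition tautology :: "fm \<Rightarrow> bool" where
  "tautology A \<longleftrightarrow> (\<forall>v. truth v A)"

definition modal_logic :: "fm set \<Rightarrow> bool" where
  "modal_logic L \<longleftrightarrow>
     (\<forall>A. tautology A \<longrightarrow> A \<in> L) \<and>
     (\<forall>A B. A \<in> L \<longrightarrow> Imp A B \<in> L \<longrightarrow> B \<in> L) \<and>
     (\<forall>s A. A \<in> L \<longrightarrow> subst s A \<in> L)"

definition CND :: "fm set" where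
  "CND = \<Inter> {L. modal_logic L \<and>
     (\<forall>A. A \<in> L \<longrightarrow> Box A \<in> L) \<and>
     (\<forall>A B. Imp (And (Box A) (Box B)) (Box (And A B)) \<in> L) \<and>
     (\<forall>A. Neg (And (Box A) (Box (Neg A))) \<in> L)}"

definition closure_operator :: "(fm set \<Rightarrow> fm set) \<Rightarrow> bool" where
  "closure_operator c \<longleftrightarrow>
     (\<forall>X. X \<subseteq> c X) \<and> (\<forall>X Y. X \<subseteq> Y \<longrightarrow> c X \<subseteq> c Y) \<and> (\<forall>X. c (c X) = c X)"

text \<open>The worlds are a subset of the type \<open>'w\<close>, so models of any size are captured by
  instantiating \<open>'w\<close> suitably. A statement that an arbitrary formula has a countermodel in this
  type needs \<open>'w\<close> to be infinite, as a finite type only bounds the size of the models.\<close>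

record 'w model =
  worlds :: "'w set"
  gens :: "'w \<Rightarrow> fm set"
  cl :: "fm set \<Rightarrow> fm set"
  forces :: "'w \<Rightarrow> fm \<Rightarrow> bool"

definition closure_model :: "'w model \<Rightarrow> bool" where
  "closure_model M \<longleftrightarrow>
     worlds M \<noteq> {} \<and>
     closure_operator (cl M) \<and>
     (\<forall>x \<in> worlds M.
        \<not> forces M x Bot \<and>
        (\<forall>A. forces M x (Neg A) \<longleftrightarrow> \<not> forces M x A) \<and>
        (\<forall>A B. forces M x (And A B) \<longleftrightarrow> forces M x A \<and> forces M x B) \<and>
        (\<forall>A B. forces M x (Or A B) \<longleftrightarrow> forces M x A \<or> forces M x B) \<and>
        (\<forall>A B. forces M x (Imp A B) \<longleftrightarrow> (forces M x A \<longrightarrow> forces M x B)) \<and>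
        (\<forall>A. forces M x (Box A) \<longleftrightarrow> A \<in> cl M (gens M x)))"

definition valid_in :: "'w model \<Rightarrow> fm \<Rightarrow> bool" where
  "valid_in M A \<longleftrightarrow> (\<forall>x \<in> worlds M. forces M x A)"

definition cond_N :: "'w model \<Rightarrow> bool" where
  "cond_N M \<longleftrightarrow> (\<forall>x \<in> worlds M. \<forall>A. valid_in M A \<longrightarrow> A \<in> cl M (gens M x))"

definition cond_C :: "'w model \<Rightarrow> bool" where
  "cond_C M \<longleftrightarrow> (\<forall>x \<in> worlds M. \<forall>A B.
     A \<in> cl M (gens M x) \<and> B \<in> cl M (gens M x) \<longrightarrow> And A B \<in> cl M (gens M x))"

definition cond_D :: "'w model \<Rightarrow> bool" where
  "cond_D M \<longleftrightarrow> (\<forall>x \<in> worlds M. \<forall>A.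
     A \<in> cl M (gens M x) \<longrightarrow> Neg A \<notin> cl M (gens M x))"

text \<open>\<open>prim_rec k f\<close>: \<open>f\<close> is primitive recursive of arity \<open>k\<close>. Only the values of \<open>f\<close>
  on lists of length \<open>k\<close> are meaningful. Recursion is on the first argument.\<close>

inductive prim_rec :: "nat \<Rightarrow> (nat list \<Rightarrow> nat) \<Rightarrow> bool" where
  zero: "prim_rec k (\<lambda>_. 0)"
| succ: "prim_rec 1 (\<lambda>xs. Suc (hd xs))"
| proj: "i < k \<Longrightarrow> prim_rec k (\<lambda>xs. xs ! i)"
| comp: "prim_rec (length gs) f \<Longrightarrow> (\<forall>g \<in> set gs. prim_rec k g) \<Longrightarrow>
    prim_rec k (\<lambda>xs. f (map (\<lambda>g. g xs) gs))"
| recursion: "prim_rec k f \<Longrightarrow> prim_rec (k + 2) g \<Longrightarrow>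
    prim_rec (k + 1) (\<lambda>xs. rec_nat (f (tl xs)) (\<lambda>n r. g (n # r # tl xs)) (hd xs))"

definition prim_rec_set :: "nat set \<Rightarrow> bool" where
  "prim_rec_set S \<longleftrightarrow> (\<exists>f. prim_rec 1 f \<and> (\<forall>m. f [m] = (if m \<in> S then 1 else 0)))"

definition prim_rec_rel :: "(nat \<times> nat) set \<Rightarrow> bool" where
  "prim_rec_rel R \<longleftrightarrow>
     (\<exists>f. prim_rec 2 f \<and> (\<forall>m n. f [m, n] = (if (m, n) \<in> R then 1 else 0)))"

primrec fm_code :: "fm \<Rightarrow> nat" where
  "fm_code (Var n) = prod_encode (0, n)"
| "fm_code Bot = prod_encode (1, 0)"
| "fm_code (Neg A) = prod_encode (2, fm_code A)"
| "fm_code (And A B) = prod_encode (3, prod_encode (fm_code A, fm_code B))"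
| "fm_code (Or A B) = prod_encode (4, prod_encode (fm_code A, fm_code B))"
| "fm_code (Imp A B) = prod_encode (5, prod_encode (fm_code A, fm_code B))"
| "fm_code (Box A) = prod_encode (6, fm_code A)"

text \<open>Formulas have the fixed Goedel numbering \<open>fm_code\<close>; the injective coding \<open>e\<close> of the worlds
  is part of the presentation and may be any that makes the three relations primitive
  recursive.\<close>

definition prim_rec_presented :: "'w model \<Rightarrow> bool" where
  "prim_rec_presented M \<longleftrightarrow> (\<exists>e :: 'w \<Rightarrow> nat. inj_on e (worlds M) \<and>
     prim_rec_set (e ` worlds M) \<and>
     prim_rec_rel {(e x, fm_code (Var i)) | x i. x \<in> worlds M \<and> forces M x (Var i)} \<and>
     prim_rec_rel {(e x, fm_code B) | x B. x \<in> worlds M \<and> B \<in> cl M (gens M x)})"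

end

theory Submission
  imports Defs
begin

text \<open>
  Soundness: the formulas valid in all closure models satisfying (N), (C) and (D) form a modal logic
  with the closure properties that define \<^const>\<open>CND\<close>. Only closure under substitution needs an
  argument: reading every formula through a substitution \<open>s\<close> turns a model into another model of
  the same kind (\<open>subst_model_closed\<close>).

  Completeness: if \<open>A\<close> is not derivable, there is a finite countermodel. Its worlds \<open>x\<close> correspond
  to the traces \<open>b x = S \<inter> subfms A\<close> of maximal consistent sets \<open>S\<close>, and its closure operator is
  the identity, so that a world is given a valuation and a set of necessary formulas. The formula
  \<open>B\<close> is put into the latter set iff \<open>Box B\<close> belongs to \<open>b x\<close>, or \<open>B\<close> is true at every world, or
  \<open>B\<close> is a conjunction of two formulas already put there. This is a recursion on \<open>B\<close>, simultaneous
  with that of forcing (\<open>ext\<close> and \<open>nbh\<close>), and (N) and (C) hold by construction. The truth lemma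
  holds for subformulas of \<open>A\<close>. For (D), every necessary formula \<open>B\<close> of a world, subformula of \<open>A\<close>
  or not, follows at all worlds from some \<open>E\<close> with \<open>Box E\<close> in the maximal consistent set
  (\<open>nbh_witness\<close>). If \<open>B\<close> and \<open>Neg B\<close> were both necessary, the conjunction of the two witnesses
  would be refutable, contradicting necessitation and the axioms C and D.

  The model is primitive recursively presented because the truth set of \<open>B\<close>, the set of worlds where
  \<open>B\<close> is necessary, and the identity of \<open>B\<close> if it is a subformula of \<open>A\<close>, together take finitely
  many values and are determined by the same data for the immediate subformulas. Formulas are thus
  classified by a finite bottom-up tree automaton, which course-of-values recursion on the
  Goedel numbers simulates (\<open>prim_rec_rel_compositional\<close>).
\<close>

section \<open>Primitive recursive functions\<close>

text \<open>The predicate \<^const>\<open>prim_rec\<close> is sensitive to values on lists of the wrong length. Its closure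
  under equality on lists of length \<open>k\<close> has the usual closure properties up to equality of
  functions of \<open>k\<close> arguments.\<close>

definition pr :: "nat \<Rightarrow> (nat list \<Rightarrow> nat) \<Rightarrow> bool" where
  "pr k f \<longleftrightarrow> (\<exists>g. prim_rec k g \<and> (\<forall>xs. length xs = k \<longrightarrow> g xs = f xs))"

lemma pr_cong: "pr k f \<Longrightarrow> (\<And>xs. length xs = k \<Longrightarrow> f xs = g xs) \<Longrightarrow> pr k g"
  unfolding pr_def by fastforce

lemma pr_proj: "i < k \<Longrightarrow> pr k (\<lambda>xs. xs ! i)"
  unfolding pr_def using prim_rec.proj by blast

lemma pr_comp:
  assumes "pr (length gs) f" and "\<forall>g \<in> set gs. pr k g"
  shows "pr k (\<lambda>xs. f (map (\<lambda>g. g xs) gs))"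
proof -
  obtain f' where f': "prim_rec (length gs) f'" "\<And>xs. length xs = length gs \<Longrightarrow> f' xs = f xs"
    using assms(1) unfolding pr_def by blast
  obtain r where r: "\<And>g. g \<in> set gs \<Longrightarrow> prim_rec k (r g)"
      "\<And>g xs. g \<in> set gs \<Longrightarrow> length xs = k \<Longrightarrow> r g xs = g xs"
    using bchoice[of "set gs" "\<lambda>g g'. prim_rec k g' \<and> (\<forall>xs. length xs = k \<longrightarrow> g' xs = g xs)"] assms(2)
    unfolding pr_def by blast
  have "prim_rec k (\<lambda>xs. f' (map (\<lambda>g. g xs) (map r gs)))"
    using f'(1) r(1) by (intro prim_rec.comp) auto
  moreover have "f' (map (\<lambda>g. g xs) (map r gs)) = f (map (\<lambda>g. g xs) gs)" if "length xs = k" for xs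
  proof -
    have eq: "map (\<lambda>g. g xs) (map r gs) = map (\<lambda>g. g xs) gs"
      using r(2) that by simp
    show ?thesis
      using f'(2)[of "map (\<lambda>g. g xs) gs"] unfolding eq by simp
  qed
  ultimately show ?thesis
    unfolding pr_def by blast
qed

lemma pr_comp1: "pr 1 (\<lambda>xs. f (xs ! 0)) \<Longrightarrow> pr k g \<Longrightarrow> pr k (\<lambda>xs. f (g xs))"
  using pr_comp[of "[g]" "\<lambda>xs. f (xs ! 0)" k] by simp

lemma pr_comp2:
  "pr 2 (\<lambda>xs. f (xs ! 0) (xs ! 1)) \<Longrightarrow> pr k g \<Longrightarrow> pr k h \<Longrightarrow> pr k (\<lambda>xs. f (g xs) (h xs))"
  using pr_comp[of "[g, h]" "\<lambda>xs. f (xs ! 0) (xs ! 1)" k] by (simp add: numeral_2_eq_2)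

lemma pr_Suc: "pr k f \<Longrightarrow> pr k (\<lambda>xs. Suc (f xs))"
proof (rule pr_comp1[where f = Suc])
  show "pr 1 (\<lambda>xs. Suc (xs ! 0))"
    unfolding pr_def using prim_rec.succ by (metis One_nat_def hd_conv_nth length_0_conv nat.simps(3))
qed

lemma pr_const: "pr k (\<lambda>_. c)"
proof (induction c)
  case 0
  then show ?case
    unfolding pr_def using prim_rec.zero by blast
qed (rule pr_Suc)

text \<open>Recursion without and with one parameter. As the bounds and parameters are themselves functions
  of the ambient argument list, the rules compose without explicit projections.\<close>

lemma pr_rec1:
  assumes s: "pr 2 (\<lambda>xs. s (xs ! 0) (xs ! 1))" and "pr k m"
  shows "pr k (\<lambda>xs. rec_nat c s (m xs))"
proof (rule pr_comp1[OF _ assms(2)])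
  obtain b where b: "prim_rec 0 b" "\<And>xs. length xs = 0 \<Longrightarrow> b xs = c"
    using pr_const[of 0 c] unfolding pr_def by blast
  obtain g where g: "prim_rec 2 g" "\<And>xs. length xs = 2 \<Longrightarrow> g xs = s (xs ! 0) (xs ! 1)"
    using s unfolding pr_def by blast
  have g': "g [n, r] = s n r" for n r
    using g(2)[of "[n, r]"] by simp
  have "prim_rec (0 + 1) (\<lambda>xs. rec_nat (b (tl xs)) (\<lambda>n r. g (n # r # tl xs)) (hd xs))"
    using b(1) g(1) by (intro prim_rec.recursion) (auto simp: numeral_2_eq_2)
  moreover have "rec_nat (b (tl xs)) (\<lambda>n r. g (n # r # tl xs)) (hd xs) = rec_nat c s (xs ! 0)"
    if "length xs = 1" for xs
    using that b(2) by (auto simp: length_Suc_conv g')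
  ultimately show "pr 1 (\<lambda>xs. rec_nat c s (xs ! 0))"
    unfolding pr_def by auto
qed

lemma pr_rec2:
  assumes b: "pr 1 (\<lambda>xs. b (xs ! 0))" and s: "pr 3 (\<lambda>xs. s (xs ! 0) (xs ! 1) (xs ! 2))"
    and "pr k m" "pr k p"
  shows "pr k (\<lambda>xs. rec_nat (b (p xs)) (\<lambda>n r. s n r (p xs)) (m xs))"
proof (rule pr_comp2[OF _ assms(3,4), of "\<lambda>m p. rec_nat (b p) (\<lambda>n r. s n r p) m"])
  obtain b' where b': "prim_rec 1 b'" "\<And>xs. length xs = 1 \<Longrightarrow> b' xs = b (xs ! 0)"
    using b unfolding pr_def by blast
  obtain g where g: "prim_rec 3 g" "\<And>xs. length xs = 3 \<Longrightarrow> g xs = s (xs ! 0) (xs ! 1) (xs ! 2)"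
    using s unfolding pr_def by blast
  have g': "g [n, r, p] = s n r p" for n r p
    using g(2)[of "[n, r, p]"] by simp
  have "prim_rec (1 + 1) (\<lambda>xs. rec_nat (b' (tl xs)) (\<lambda>n r. g (n # r # tl xs)) (hd xs))"
    using b'(1) g(1) by (intro prim_rec.recursion) (auto simp: numeral_3_eq_3)
  moreover have "rec_nat (b' (tl xs)) (\<lambda>n r. g (n # r # tl xs)) (hd xs)
      = rec_nat (b (xs ! 1)) (\<lambda>n r. s n r (xs ! 1)) (xs ! 0)"
    if "length xs = 2" for xs
    using that b'(2) by (auto simp: length_Suc_conv numeral_2_eq_2 g')
  ultimately show "pr 2 (\<lambda>xs. rec_nat (b (xs ! 1)) (\<lambda>n r. s n r (xs ! 1)) (xs ! 0))"
    unfolding pr_def one_add_one by blast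
qed

lemma pr_add:
  assumes "pr k f" "pr k g"
  shows "pr k (\<lambda>xs. f xs + g xs)"
proof -
  have "rec_nat x (\<lambda>_ r. Suc r) n = n + x" for n x :: nat
    by (induction n) auto
  then show ?thesis
    using pr_rec2[of "\<lambda>x. x" "\<lambda>_ r _. Suc r" k f g] assms by (simp add: pr_proj pr_Suc)
qed

lemma pr_pred:
  assumes "pr k f"
  shows "pr k (\<lambda>xs. f xs - 1)"
proof -
  have "rec_nat 0 (\<lambda>n _. n) n = n - 1" for n :: nat
    by (cases n) auto
  then show ?thesis
    using pr_rec1[of "\<lambda>n _. n" k f 0] assms by (simp add: pr_proj)
qed

lemma pr_diff:
  assumes "pr k f" "pr k g"
  shows "pr k (\<lambda>xs. f xs - g xs)"
proof -
  have "rec_nat x (\<lambda>_ r. r - 1) n = x - n" for n x :: nat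
    by (induction n) auto
  then show ?thesis
    using pr_rec2[of "\<lambda>x. x" "\<lambda>_ r _. r - 1" k g f] assms
    by (simp only: pr_proj pr_pred less_numeral_extra)
qed

lemma pr_mult:
  assumes "pr k f" "pr k g"
  shows "pr k (\<lambda>xs. f xs * g xs)"
proof -
  have "rec_nat 0 (\<lambda>_ r. x + r) n = n * x" for n x :: nat
    by (induction n) auto
  then show ?thesis
    using pr_rec2[of "\<lambda>_. 0" "\<lambda>_ r x. x + r" k f g] assms
    by (simp add: pr_proj pr_const pr_add)
qed

lemma pr_triangle:
  assumes "pr k f"
  shows "pr k (\<lambda>xs. triangle (f xs))"
proof -
  have "rec_nat 0 (\<lambda>n r. r + Suc n) n = triangle n" for n :: nat
    by (induction n) auto
  then show ?thesis
    using pr_rec1[of "\<lambda>n r. r + Suc n" k f 0] assms by (simp only: pr_proj pr_add pr_Suc)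
qed

lemma pr_prod_encode:
  "pr k f \<Longrightarrow> pr k g \<Longrightarrow> pr k (\<lambda>xs. prod_encode (f xs, g xs))"
  by (simp add: prod_encode_def pr_add pr_triangle)

lemma pr_le:
  assumes "pr k f" "pr k g"
  shows "pr k (\<lambda>xs. of_bool (f xs \<le> g xs))"
proof -
  have "pr k (\<lambda>xs. 1 - (f xs - g xs))"
    by (intro pr_diff pr_const assms)
  then show ?thesis
    by (rule pr_cong) auto
qed

lemma pr_eq:
  assumes "pr k f" "pr k g"
  shows "pr k (\<lambda>xs. of_bool (f xs = g xs))"
proof -
  have "pr k (\<lambda>xs. of_bool (f xs \<le> g xs) * of_bool (g xs \<le> f xs))"
    by (intro pr_mult pr_le assms)
  then show ?thesis
    by (rule pr_cong) auto
qed

lemma pr_if: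
  assumes "pr k (\<lambda>xs. of_bool (P xs))" "pr k f" "pr k g"
  shows "pr k (\<lambda>xs. if P xs then f xs else g xs)"
proof -
  have "pr k (\<lambda>xs. of_bool (P xs) * f xs + (1 - of_bool (P xs)) * g xs)"
    by (intro pr_add pr_mult pr_diff pr_const assms)
  then show ?thesis
    by (rule pr_cong) auto
qed

text \<open>A function that is constant up to finitely many exceptions is primitive recursive: a finite table
  of values, whatever its origin, can be built in.\<close>

lemma pr_finite_modification:
  assumes "finite {n. f n \<noteq> c}" and g: "pr k g"
  shows "pr k (\<lambda>xs. f (g xs))"
proof -
  have "pr k (\<lambda>xs. f (g xs))" if "finite D" "{n. f n \<noteq> c} \<subseteq> D" for D f
    using that
  proof (induction D arbitrary: f rule: finite_induct)
    case empty
    then have "f = (\<lambda>_. c)" by auto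
    then show ?case by (simp add: pr_const)
  next
    case (insert a D)
    have IH: "pr k (\<lambda>xs. (f(a := c)) (g xs))"
      using insert.prems by (intro insert.IH) auto
    have "pr k (\<lambda>xs. if g xs = a then f a else (f(a := c)) (g xs))"
      by (intro pr_if[OF pr_eq[OF g pr_const] pr_const IH])
    then show ?case
      by (rule pr_cong) auto
  qed
  then show ?thesis
    using assms(1) by blast
qed

lemma pr_finite_set:
  assumes "finite S" and "pr k g"
  shows "pr k (\<lambda>xs. of_bool (g xs \<in> S))"
proof (rule pr_finite_modification[OF _ assms(2)])
  show "finite {n. of_bool (n \<in> S) \<noteq> (0 :: nat)}"
    using assms(1) by simp
qed

lemma prim_rec_set_finite:
  assumes "finite S"
  shows "prim_rec_set S"
proof -
  have "pr 1 (\<lambda>xs. of_bool (xs ! 0 \<in> S))"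
    using assms by (rule pr_finite_set) (rule pr_proj, simp)
  then obtain f where "prim_rec 1 f" "\<And>xs. length xs = 1 \<Longrightarrow> f xs = of_bool (xs ! 0 \<in> S)"
    unfolding pr_def by blast
  then show ?thesis
    unfolding prim_rec_set_def by (intro exI[of _ f]) simp
qed

lemma prim_rec_relI:
  assumes "pr 2 (\<lambda>xs. of_bool ((xs ! 0, xs ! 1) \<in> R))"
  shows "prim_rec_rel R"
proof -
  obtain f where "prim_rec 2 f" "\<And>xs. length xs = 2 \<Longrightarrow> f xs = of_bool ((xs ! 0, xs ! 1) \<in> R)"
    using assms unfolding pr_def by blast
  then show ?thesis
    unfolding prim_rec_rel_def by (intro exI[of _ f]) simp
qed

lemma prim_rec_rel_finite:
  assumes "finite R"
  shows "prim_rec_rel R"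
proof (rule prim_rec_relI)
  have "pr 2 (\<lambda>xs. of_bool (prod_encode (xs ! 0, xs ! 1) \<in> prod_encode ` R))"
    using assms by (intro pr_finite_set pr_prod_encode pr_proj) auto
  then show "pr 2 (\<lambda>xs. of_bool ((xs ! 0, xs ! 1) \<in> R))"
    by (rule pr_cong) (auto simp: image_iff)
qed

section \<open>Decoding pairs and course-of-values recursion\<close>

text \<open>The sum of the components of the pair coded by \<open>n\<close>, that is, the index of the diagonal on which
  Cantor's enumeration places it.\<close>

definition diagonal :: "nat \<Rightarrow> nat" where
  "diagonal = rec_nat 0 (\<lambda>n d. if triangle (Suc d) \<le> Suc n then Suc d else d)"

lemma diagonal_bounds: "triangle (diagonal n) \<le> n \<and> n < triangle (Suc (diagonal n))"
  by (induction n) (auto simp: diagonal_def)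

lemma prod_decode_diagonal:
  "prod_decode n = (n - triangle (diagonal n), diagonal n - (n - triangle (diagonal n)))"
proof -
  have "prod_encode (n - triangle (diagonal n), diagonal n - (n - triangle (diagonal n))) = n"
    using diagonal_bounds[of n] by (simp add: prod_encode_def)
  then show ?thesis
    by (metis prod_encode_inverse)
qed

lemma pr_diagonal:
  assumes "pr k f"
  shows "pr k (\<lambda>xs. diagonal (f xs))"
proof -
  have "pr 2 (\<lambda>xs. if triangle (Suc (xs ! 1)) \<le> Suc (xs ! 0) then Suc (xs ! 1) else xs ! 1)"
    by (intro pr_if pr_le pr_triangle pr_Suc pr_proj) simp_all
  from pr_rec1[of "\<lambda>n d. if triangle (Suc d) \<le> Suc n then Suc d else d", OF this assms]
  show ?thesis
    unfolding diagonal_def .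
qed

lemma pr_fst_decode: "pr k f \<Longrightarrow> pr k (\<lambda>xs. fst (prod_decode (f xs)))"
  unfolding prod_decode_diagonal fst_conv by (intro pr_diff pr_triangle pr_diagonal)

lemma pr_snd_decode: "pr k f \<Longrightarrow> pr k (\<lambda>xs. snd (prod_decode (f xs)))"
  unfolding prod_decode_diagonal snd_conv by (intro pr_diff pr_triangle pr_diagonal)

text \<open>The values of \<open>F\<close> below \<open>n\<close>, packed into nested pairs with the most recent value outermost.\<close>

primrec hist :: "(nat \<Rightarrow> nat) \<Rightarrow> nat \<Rightarrow> nat" where
  "hist F 0 = 0"
| "hist F (Suc n) = prod_encode (F n, hist F n)"

text \<open>The value at \<open>i\<close> recorded in a history \<open>h\<close> of length \<open>n\<close>; it is meaningful for \<open>i < n\<close>.\<close>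

definition lookup :: "nat \<Rightarrow> nat \<Rightarrow> nat \<Rightarrow> nat" where
  "lookup n h i = fst (prod_decode (rec_nat h (\<lambda>_ r. snd (prod_decode r)) (n - Suc i)))"

lemma lookup_hist:
  assumes "i < n"
  shows "lookup n (hist F n) i = F i"
proof -
  have "rec_nat (hist F (m + j)) (\<lambda>_ r. snd (prod_decode r)) j = hist F m" for m j
  proof (induction j arbitrary: m)
    case (Suc j)
    have "rec_nat (hist F (m + Suc j)) (\<lambda>_ r. snd (prod_decode r)) j = hist F (Suc m)"
      using Suc[of "Suc m"] by simp
    then show ?case
      by simp
  qed simp
  from this[of "Suc i" "n - Suc i"] show ?thesis
    using assms by (simp add: lookup_def)
qed

lemma pr_lookup:
  assumes "pr k n" "pr k h" "pr k i"
  shows "pr k (\<lambda>xs. lookup (n xs) (h xs) (i xs))"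
proof -
  have "pr 1 (\<lambda>xs. xs ! 0)" "pr 3 (\<lambda>xs. snd (prod_decode (xs ! 1)))"
    by (intro pr_snd_decode pr_proj; simp)+
  moreover have "pr k (\<lambda>xs. n xs - Suc (i xs))"
    by (intro pr_diff pr_Suc assms)
  ultimately have "pr k (\<lambda>xs. rec_nat (h xs) (\<lambda>_ r. snd (prod_decode r)) (n xs - Suc (i xs)))"
    using assms(2) by (rule pr_rec2[of "\<lambda>h. h" "\<lambda>_ r _. snd (prod_decode r)"])
  then show ?thesis
    unfolding lookup_def by (rule pr_fst_decode)
qed

lemma pr_course_of_values:
  assumes G: "pr 2 (\<lambda>xs. G (xs ! 0) (xs ! 1))" and F: "\<And>n. F n = G n (hist F n)" and m: "pr k m"
  shows "pr k (\<lambda>xs. F (m xs))"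
proof -
  have "hist F n = rec_nat 0 (\<lambda>n h. prod_encode (G n h, h)) n" for n
  proof (induction n)
    case (Suc n)
    have "hist F (Suc n) = prod_encode (G n (hist F n), hist F n)"
      by (simp flip: F)
    also have "\<dots> = rec_nat 0 (\<lambda>n h. prod_encode (G n h, h)) (Suc n)"
      by (simp add: Suc)
    finally show ?case .
  qed simp
  moreover have "pr k (\<lambda>xs. rec_nat 0 (\<lambda>n h. prod_encode (G n h, h)) (m xs))"
    by (intro pr_rec1 pr_prod_encode G m pr_proj) simp
  ultimately have "pr k (\<lambda>xs. hist F (m xs))"
    by simp
  then have "pr k (\<lambda>xs. G (m xs) (hist F (m xs)))"
    by (intro pr_comp2[OF G] m)
  then show ?thesis
    by (simp flip: F)
qed

section \<open>Properties of formulas decided by a finite tree automaton\<close>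

lemma fm_code_eq_iff: "fm_code A = fm_code B \<longleftrightarrow> A = B"
proof (induction A arbitrary: B)
  case (Var n)
  show ?case by (cases B) simp_all
next
  case Bot
  show ?case by (cases B) simp_all
next
  case (Neg A)
  then show ?case by (cases B) simp_all
next
  case (And A1 A2)
  then show ?case by (cases B) simp_all
next
  case (Or A1 A2)
  then show ?case by (cases B) simp_all
next
  case (Imp A1 A2)
  then show ?case by (cases B) simp_all
next
  case (Box A)
  then show ?case by (cases B) simp_all
qed

lemma inj_fm_code: "inj fm_code"
  by (simp add: inj_def fm_code_eq_iff)

text \<open>The map \<open>st\<close> sends a formula to its state. The congruence assumptions say that the state of a
  compound formula depends only on the states of its immediate subformulas, so that the transition
  functions are finite tables; the table for variables is constant up to finitely many exceptions.
  Hence any relation between the worlds of a finite set and formulas that depends only on the state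
  of the formula is primitive recursive.\<close>

lemma prim_rec_rel_compositional:
  fixes st :: "fm \<Rightarrow> 's" and e :: "'w \<Rightarrow> nat"
  assumes fin: "finite (range st)" and finV: "finite {i. st (Var i) \<noteq> c}"
    and comp1: "\<And>A A'. st A = st A' \<Longrightarrow> st (Neg A) = st (Neg A') \<and> st (Box A) = st (Box A')"
    and comp2: "\<And>A A' B B'. st A = st A' \<Longrightarrow> st B = st B' \<Longrightarrow>
      st (And A B) = st (And A' B') \<and> st (Or A B) = st (Or A' B') \<and> st (Imp A B) = st (Imp A' B')"
    and W: "finite W"
    and Q: "\<And>x A A'. x \<in> W \<Longrightarrow> st A = st A' \<Longrightarrow> Q x A \<Longrightarrow> Q x A'"
  shows "prim_rec_rel {(e x, fm_code B) | x B. x \<in> W \<and> Q x B}"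
proof -
  obtain g :: "'s \<Rightarrow> nat" where g: "inj_on g (range st)"
    using finite_imp_inj_to_nat_seg[OF fin] by blast
  \<comment> \<open>States are coded by positive numbers; 0 marks the numbers that code no formula.\<close>
  define q where "q A = Suc (g (st A))" for A
  have q_iff: "q A = q B \<longleftrightarrow> st A = st B" for A B
    using g by (auto simp: q_def inj_on_def)
  have finq: "finite (range q)"
    using finite_imageI[OF fin, of "\<lambda>s. Suc (g s)"] by (simp add: image_image q_def[abs_def])
  have zero: "0 \<notin> range q"
    by (auto simp: q_def)
  have q_inv: "st (inv q (q A)) = st A" for A
    by (metis f_inv_into_f q_iff rangeI)
  \<comment> \<open>The transition tables: by congruence any formula in the given state may represent it.\<close>
  define u1 where "u1 f n = (if n \<in> range q then q (f (inv q n)) else 0)" for f n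
  define u2 where "u2 f n m = (if n \<in> range q \<and> m \<in> range q then q (f (inv q n) (inv q m)) else 0)"
    for f n m
  have u1: "u1 Neg (q A) = q (Neg A)" "u1 Box (q A) = q (Box A)" for A
    using comp1[OF q_inv[of A]] by (auto simp: u1_def q_def)
  have u2: "u2 And (q A) (q B) = q (And A B)" "u2 Or (q A) (q B) = q (Or A B)"
    "u2 Imp (q A) (q B) = q (Imp A B)" for A B
    using comp2[OF q_inv[of A] q_inv[of B]] by (auto simp: u2_def q_def)
  have u1_0: "u1 f 0 = 0" for f
    using zero by (simp add: u1_def)
  have u2_0: "u2 f n m = 0" if "n = 0 \<or> m = 0" for f n m
    using zero that by (auto simp: u2_def)
  have pr_u1: "pr k (\<lambda>xs. u1 f (a xs))" if "pr k a" for k f a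
  proof (rule pr_finite_modification[OF _ that])
    show "finite {n. u1 f n \<noteq> 0}"
      by (rule finite_subset[OF _ finq]) (auto simp: u1_def)
  qed
  have pr_u2: "pr k (\<lambda>xs. u2 f (a xs) (b xs))" if "pr k a" "pr k b" for k f a b
  proof -
    let ?f = "\<lambda>p. u2 f (fst (prod_decode p)) (snd (prod_decode p))"
    have "{p. ?f p \<noteq> 0} \<subseteq> prod_encode ` (range q \<times> range q)"
    proof
      fix p assume "p \<in> {p. ?f p \<noteq> 0}"
      then have "prod_decode p \<in> range q \<times> range q"
        by (auto simp: u2_def mem_Times_iff split: if_splits)
      then show "p \<in> prod_encode ` (range q \<times> range q)"
        by (metis imageI prod_decode_inverse)
    qed
    then have "finite {p. ?f p \<noteq> 0}"
      using finq by (meson finite_SigmaI finite_imageI finite_subset)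
    then have "pr k (\<lambda>xs. ?f (prod_encode (a xs, b xs)))"
      using that by (intro pr_finite_modification[where f = ?f and c = 0] pr_prod_encode)
    then show ?thesis
      by simp
  qed
  define F where "F n = (if n \<in> range fm_code then q (inv fm_code n) else 0)" for n
  have F_code: "F (fm_code A) = q A" for A
    by (simp add: F_def inj_fm_code)
  have F_0: "F n = 0" if "n \<notin> range fm_code" for n
    using that by (simp add: F_def)
  \<comment> \<open>One transition: \<open>t\<close> is the tag of the code, \<open>m\<close> its content, \<open>x\<close> the value of \<open>F\<close> at \<open>m\<close>,
    and \<open>a\<close>, \<open>b\<close> its values at the two components of \<open>m\<close>.\<close>
  define step where "step t m x a b =
    (if t = 0 then q (Var m)
     else if t = 1 then (if m = 0 then q Bot else 0)
     else if t = 2 then u1 Neg x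
     else if t = 3 then u2 And a b
     else if t = 4 then u2 Or a b
     else if t = 5 then u2 Imp a b
     else if t = 6 then u1 Box x
     else 0)" for t m x a b :: nat
  have F_step: "F (prod_encode (t, m))
      = step t m (F m) (F (fst (prod_decode m))) (F (snd (prod_decode m)))" for t m
  proof (cases "prod_encode (t, m) \<in> range fm_code")
    case True
    then obtain A where A: "prod_encode (t, m) = fm_code A" by blast
    show ?thesis
      unfolding A F_code using A by (cases A) (auto simp: step_def F_code u1 u2)
  next
    case False
    have "m \<notin> range fm_code" if "t = 2 \<or> t = 6"
    proof
      assume "m \<in> range fm_code"
      then obtain B where "m = fm_code B" by blast
      then show False
        using False that rangeI[of fm_code "Neg B"] rangeI[of fm_code "Box B"] by auto
    qed
    then have no: "F m = 0" if "t = 2 \<or> t = 6"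
      using that F_0 by blast
    have no2: "F (fst (prod_decode m)) = 0 \<or> F (snd (prod_decode m)) = 0"
      if t: "t = 3 \<or> t = 4 \<or> t = 5"
    proof (rule ccontr)
      assume "\<not> ?thesis"
      then obtain A B where AB: "fst (prod_decode m) = fm_code A" "snd (prod_decode m) = fm_code B"
        using F_0[of "fst (prod_decode m)"] F_0[of "snd (prod_decode m)"] by auto
      have "m = prod_encode (fst (prod_decode m), snd (prod_decode m))"
        by simp
      then have "m = prod_encode (fm_code A, fm_code B)"
        unfolding AB .
      then show False
        using False t rangeI[of fm_code "And A B"] rangeI[of fm_code "Or A B"]
          rangeI[of fm_code "Imp A B"] by auto
    qed
    have "t \<noteq> 0" "t = 1 \<longrightarrow> m \<noteq> 0"
      using False rangeI[of fm_code "Var m"] rangeI[of fm_code Bot] by auto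
    with no no2 show ?thesis
      unfolding F_0[OF False] step_def using u1_0 u2_0 by auto
  qed
  define G where "G n h =
    (let t = fst (prod_decode n); m = snd (prod_decode n) in
      step t m (lookup n h m) (lookup n h (fst (prod_decode m))) (lookup n h (snd (prod_decode m))))"
    for n h
  have F_G: "F n = G n (hist F n)" for n
  proof -
    obtain t m where tm: "prod_decode n = (t, m)" by fastforce
    then have n: "n = prod_encode (t, m)"
      by (metis prod_decode_inverse)
    obtain a b where ab: "prod_decode m = (a, b)" by fastforce
    then have m: "m = prod_encode (a, b)"
      by (metis prod_decode_inverse)
    \<comment> \<open>For the tags 0 and 1 the content need not be smaller than the code, but then the table
      does not consult the history.\<close>
    have step_small: "step t m x y z = step t m x' y' z'" if "t < 2" for x y z x' y' z'
      using that by (auto simp: step_def)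
    show ?thesis
    proof (cases "t < 2")
      case True
      then show ?thesis
        unfolding G_def Let_def tm fst_conv snd_conv unfolding n F_step by (rule step_small)
    next
      case False
      then have "m < n"
        unfolding n using le_prod_encode_2[of "t + m" 0] by (simp add: prod_encode_def)
      moreover have "a \<le> m" "b \<le> m"
        unfolding m by (rule le_prod_encode_1 le_prod_encode_2)+
      ultimately show ?thesis
        using F_step[of t m] by (simp add: G_def tm ab lookup_hist flip: n)
    qed
  qed
  have pr_G: "pr 2 (\<lambda>xs. G (xs ! 0) (xs ! 1))"
  proof -
    have "finite {i. q (Var i) \<noteq> Suc (g c)}"
      by (rule finite_subset[OF _ finV]) (auto simp: q_def)
    then have pr_Var: "pr k (\<lambda>xs. q (Var (a xs)))" if "pr k a" for k a
      using that by (rule pr_finite_modification)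
    show ?thesis
      unfolding G_def Let_def step_def
      by (intro pr_if pr_eq pr_const pr_Var pr_u1 pr_u2 pr_lookup pr_fst_decode pr_snd_decode pr_proj)
        simp_all
  qed
  let ?R = "{(e x, fm_code B) | x B. x \<in> W \<and> Q x B}"
  let ?S = "{prod_encode (e x, q B) | x B. x \<in> W \<and> Q x B}"
  have "?S \<subseteq> prod_encode ` (e ` W \<times> range q)"
    by auto
  then have "finite ?S"
    by (rule finite_subset) (use W finq in auto)
  then have "pr 2 (\<lambda>xs. of_bool (prod_encode (xs ! 0, F (xs ! 1)) \<in> ?S))"
    by (intro pr_finite_set pr_prod_encode pr_course_of_values[OF pr_G F_G] pr_proj) simp_all
  moreover have "prod_encode (i, F n) \<in> ?S \<longleftrightarrow> (i, n) \<in> ?R" for i n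
  proof
    assume "prod_encode (i, F n) \<in> ?S"
    then obtain x B where xB: "i = e x" "F n = q B" "x \<in> W" "Q x B" by auto
    then obtain A where "n = fm_code A"
      using F_0[of n] zero by (cases "n \<in> range fm_code") auto
    then show "(i, n) \<in> ?R"
      using xB Q[of x B A] by (auto simp: F_code q_iff)
  next
    assume "(i, n) \<in> ?R"
    then obtain x B where xB: "i = e x" "n = fm_code B" "x \<in> W" "Q x B"
      by blast
    then have "prod_encode (i, F n) = prod_encode (e x, q B)"
      by (simp add: F_code)
    then show "prod_encode (i, F n) \<in> ?S"
      using xB(3,4) by blast
  qed
  ultimately show ?thesis
    by (intro prim_rec_relI) simp
qed

section \<open>Soundness\<close>

lemma tautology_CND: "tautology A \<Longrightarrow> A \<in> CND"
  by (auto simp: CND_def modal_logic_def)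

lemma MP_CND: "A \<in> CND \<Longrightarrow> Imp A B \<in> CND \<Longrightarrow> B \<in> CND"
  unfolding CND_def modal_logic_def by blast

lemma Nec_CND: "A \<in> CND \<Longrightarrow> Box A \<in> CND"
  unfolding CND_def by blast

lemma C_CND: "Imp (And (Box A) (Box B)) (Box (And A B)) \<in> CND"
  unfolding CND_def by blast

lemma D_CND: "Neg (And (Box A) (Box (Neg A))) \<in> CND"
  unfolding CND_def by blast

lemma truth_forces:
  assumes "closure_model M" "x \<in> worlds M"
  shows "truth (forces M x) B \<longleftrightarrow> forces M x B"
  using assms by (induction B) (auto simp: closure_model_def)

text \<open>The model \<open>M\<close> with every formula read as its substitution instance. The necessary formulas of a
  world are taken as its generators, so the identity serves as closure operator.\<close>

definition subst_model :: "(nat \<Rightarrow> fm) \<Rightarrow> 'w model \<Rightarrow> 'w model" where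
  "subst_model s M = \<lparr>worlds = worlds M, gens = (\<lambda>x. {B. subst s B \<in> cl M (gens M x)}),
     cl = id, forces = (\<lambda>x B. forces M x (subst s B))\<rparr>"

lemma valid_subst_model: "valid_in (subst_model s M) B \<longleftrightarrow> valid_in M (subst s B)"
  by (simp add: valid_in_def subst_model_def)

lemma subst_model_closed:
  assumes "closure_model M" "cond_N M" "cond_C M" "cond_D M"
  shows "closure_model (subst_model s M)" "cond_N (subst_model s M)"
    "cond_C (subst_model s M)" "cond_D (subst_model s M)"
proof -
  show "closure_model (subst_model s M)"
    using assms(1) by (simp add: closure_model_def subst_model_def closure_operator_def)
  show "cond_N (subst_model s M)"
    using assms(2) unfolding cond_N_def valid_subst_model by (simp add: subst_model_def)
  show "cond_C (subst_model s M)" "cond_D (subst_model s M)"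
    using assms(3,4) by (simp_all add: cond_C_def cond_D_def subst_model_def)
qed

lemma soundness:
  fixes M :: "'w model"
  assumes "A \<in> CND" and "closure_model M" "cond_N M" "cond_C M" "cond_D M"
  shows "valid_in M A"
proof -
  let ?ok = "\<lambda>M :: 'w model. closure_model M \<and> cond_N M \<and> cond_C M \<and> cond_D M"
  define L where "L = {A. \<forall>M :: 'w model. ?ok M \<longrightarrow> valid_in M A}"
  have "modal_logic L"
    unfolding modal_logic_def
  proof (intro conjI allI impI)
    fix A assume "tautology A"
    have "forces M x A" if "closure_model M" "x \<in> worlds M" for M :: "'w model" and x
      using truth_forces[OF that, of A] \<open>tautology A\<close> by (simp add: tautology_def)
    then show "A \<in> L"
      by (simp add: L_def valid_in_def)
  next
    fix A B assume "A \<in> L" "Imp A B \<in> L"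
    then show "B \<in> L"
      by (auto simp: L_def valid_in_def closure_model_def)
  next
    fix s A assume "A \<in> L"
    have "valid_in M (subst s A)" if "?ok M" for M
    proof -
      have "?ok (subst_model s M)"
        using that subst_model_closed by metis
      then have "valid_in (subst_model s M) A"
        using \<open>A \<in> L\<close> by (simp add: L_def)
      then show ?thesis
        by (simp add: valid_subst_model)
    qed
    then show "subst s A \<in> L"
      by (simp add: L_def)
  qed
  moreover have "Box A \<in> L" if "A \<in> L" for A
  proof -
    have "valid_in M (Box A)" if "?ok M" for M
    proof -
      have "valid_in M A"
        using that \<open>A \<in> L\<close> by (simp add: L_def)
      then show ?thesis
        using that by (simp add: valid_in_def[of M "Box A"] closure_model_def cond_N_def)
    qed
    then show ?thesis
      by (simp add: L_def)
  qed
  moreover have "Imp (And (Box A) (Box B)) (Box (And A B)) \<in> L" for A B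
    by (simp add: L_def valid_in_def closure_model_def cond_C_def)
  moreover have "Neg (And (Box A) (Box (Neg A))) \<in> L" for A
    by (simp add: L_def valid_in_def closure_model_def cond_D_def)
  ultimately have "CND \<subseteq> L"
    unfolding CND_def by (intro Inter_lower) blast
  then show ?thesis
    using assms by (auto simp: L_def)
qed

section \<open>Maximal consistent sets\<close>

text \<open>Consistent complete sets of formulas that contain the logic and are closed under Modus Ponens,
  but not necessarily under necessitation.\<close>

definition mcs :: "fm set \<Rightarrow> bool" where
  "mcs S \<longleftrightarrow> CND \<subseteq> S \<and> (\<forall>A B. A \<in> S \<longrightarrow> Imp A B \<in> S \<longrightarrow> B \<in> S) \<and>
     Bot \<notin> S \<and> (\<forall>A. A \<in> S \<or> Neg A \<in> S)"

lemma mcs_CND: "mcs S \<Longrightarrow> A \<in> CND \<Longrightarrow> A \<in> S"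
  by (auto simp: mcs_def)

lemma mcs_MP: "mcs S \<Longrightarrow> Imp A B \<in> S \<Longrightarrow> A \<in> S \<Longrightarrow> B \<in> S"
  unfolding mcs_def by blast

lemma Lindenbaum:
  assumes "A \<notin> CND"
  obtains S where "mcs S" "A \<notin> S"
proof -
  let ?closed = "\<lambda>S. CND \<subseteq> S \<and> (\<forall>B C. B \<in> S \<longrightarrow> Imp B C \<in> S \<longrightarrow> C \<in> S)"
  let ?F = "{S. ?closed S \<and> A \<notin> S}"
  have "CND \<in> ?F"
    using assms MP_CND by blast
  moreover have "\<Union>\<C> \<in> ?F" if "\<C> \<noteq> {}" "subset.chain ?F \<C>" for \<C>
  proof -
    have in_F: "?closed S \<and> A \<notin> S" if "S \<in> \<C>" for S
      using \<open>subset.chain ?F \<C>\<close> that unfolding subset_chain_def by blast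
    have total: "S \<subseteq> T \<or> T \<subseteq> S" if "S \<in> \<C>" "T \<in> \<C>" for S T
      using \<open>subset.chain ?F \<C>\<close> that unfolding subset_chain_def by blast
    have "C \<in> \<Union>\<C>" if BC: "B \<in> \<Union>\<C>" "Imp B C \<in> \<Union>\<C>" for B C
    proof -
      obtain S T where "S \<in> \<C>" "B \<in> S" "T \<in> \<C>" "Imp B C \<in> T"
        using BC by blast
      then obtain U where "U \<in> \<C>" "B \<in> U" "Imp B C \<in> U"
        using total[of S T] by blast
      then have "C \<in> U"
        using in_F[of U] by blast
      then show ?thesis
        using \<open>U \<in> \<C>\<close> by blast
    qed
    moreover have "CND \<subseteq> \<Union>\<C>" "A \<notin> \<Union>\<C>"
      using in_F \<open>\<C> \<noteq> {}\<close> by blast+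
    ultimately show ?thesis
      by blast
  qed
  ultimately obtain S where "S \<in> ?F" and max': "\<forall>T \<in> ?F. S \<subseteq> T \<longrightarrow> T = S"
    using subset_Zorn_nonempty[of ?F] by (metis (no_types, lifting) empty_iff)
  then have S: "?closed S" "A \<notin> S"
    by blast+
  have max: "T = S" if "?closed T" "A \<notin> T" "S \<subseteq> T" for T
    using max' that by blast
  have taut: "B \<in> S" if "tautology B" for B
    using S(1) tautology_CND that by blast
  have mp: "C \<in> S" if "Imp B C \<in> S" "B \<in> S" for B C
    using S(1) that by blast
  \<comment> \<open>The deduction theorem applied to a maximal set that omits \<open>A\<close>.\<close>
  have imp: "Imp B A \<in> S" if "B \<notin> S" for B
  proof (rule ccontr)
    assume "Imp B A \<notin> S"
    let ?T = "{C. Imp B C \<in> S}"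
    have ST: "S \<subseteq> ?T"
      using mp taut[of "Imp _ (Imp B _)"] by (auto simp: tautology_def)
    have "D \<in> ?T" if "C \<in> ?T" "Imp C D \<in> ?T" for C D
    proof -
      have "Imp (Imp B C) (Imp (Imp B (Imp C D)) (Imp B D)) \<in> S"
        by (rule taut) (auto simp: tautology_def)
      then show ?thesis
        using that mp by blast
    qed
    with ST S(1) have "?closed ?T"
      by blast
    then have "?T = S"
      using max \<open>Imp B A \<notin> S\<close> ST by blast
    moreover have "B \<in> ?T"
      using taut[of "Imp B B"] by (auto simp: tautology_def)
    ultimately show False
      using that by blast
  qed
  have "B \<in> S \<or> Neg B \<in> S" for B
  proof (rule ccontr)
    assume "\<not> ?thesis"
    then have "Imp B A \<in> S" "Imp (Neg B) A \<in> S"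
      using imp by auto
    moreover have "Imp (Imp B A) (Imp (Imp (Neg B) A) A) \<in> S"
      by (rule taut) (auto simp: tautology_def)
    ultimately show False
      using mp S(2) by blast
  qed
  moreover have "Bot \<notin> S"
    using taut[of "Imp Bot A"] mp S(2) by (auto simp: tautology_def)
  ultimately have "mcs S"
    using S(1) unfolding mcs_def by blast
  then show ?thesis
    using that S(2) by blast
qed

lemma mcs_Bot: "mcs S \<Longrightarrow> Bot \<notin> S"
  by (simp add: mcs_def)

lemma mcs_tautology_MP: "mcs S \<Longrightarrow> tautology (Imp A B) \<Longrightarrow> A \<in> S \<Longrightarrow> B \<in> S"
  using mcs_MP mcs_CND tautology_CND by blast

lemma mcs_Neg:
  assumes "mcs S"
  shows "Neg A \<in> S \<longleftrightarrow> A \<notin> S"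
proof -
  have "tautology (Imp (Neg A) (Imp A Bot))"
    by (simp add: tautology_def)
  then show ?thesis
    using mcs_tautology_MP[OF assms] mcs_MP[OF assms] assms unfolding mcs_def by blast
qed

lemma mcs_And:
  assumes "mcs S"
  shows "And A B \<in> S \<longleftrightarrow> A \<in> S \<and> B \<in> S"
proof -
  have "tautology (Imp (And A B) A)" "tautology (Imp (And A B) B)"
    "tautology (Imp A (Imp B (And A B)))"
    by (simp_all add: tautology_def)
  then show ?thesis
    using mcs_tautology_MP[OF assms] mcs_MP[OF assms] by blast
qed

lemma mcs_Or:
  assumes "mcs S"
  shows "Or A B \<in> S \<longleftrightarrow> A \<in> S \<or> B \<in> S"
proof -
  have "tautology (Imp A (Or A B))" "tautology (Imp B (Or A B))"
    "tautology (Imp (Or A B) (Imp (Neg A) B))"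
    by (auto simp: tautology_def)
  then show ?thesis
    using mcs_tautology_MP[OF assms] mcs_MP[OF assms] mcs_Neg[OF assms] by blast
qed

lemma mcs_Imp:
  assumes "mcs S"
  shows "Imp A B \<in> S \<longleftrightarrow> (A \<in> S \<longrightarrow> B \<in> S)"
proof -
  have "tautology (Imp (Neg A) (Imp A B))" "tautology (Imp B (Imp A B))"
    by (simp_all add: tautology_def)
  then show ?thesis
    using mcs_tautology_MP[OF assms] mcs_MP[OF assms] mcs_Neg[OF assms] by blast
qed

lemma mcs_Box_And: "mcs S \<Longrightarrow> Box A \<in> S \<Longrightarrow> Box B \<in> S \<Longrightarrow> Box (And A B) \<in> S"
  using mcs_MP mcs_CND[OF _ C_CND] mcs_And by metis

lemma mcs_Box_consistent: "mcs S \<Longrightarrow> Box A \<in> S \<Longrightarrow> Box (Neg A) \<notin> S"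
  using mcs_CND[OF _ D_CND] mcs_Neg mcs_And by metis

section \<open>The finite model\<close>

primrec subfms :: "fm \<Rightarrow> fm set" where
  "subfms (Var n) = {Var n}"
| "subfms Bot = {Bot}"
| "subfms (Neg A) = insert (Neg A) (subfms A)"
| "subfms (And A B) = insert (And A B) (subfms A \<union> subfms B)"
| "subfms (Or A B) = insert (Or A B) (subfms A \<union> subfms B)"
| "subfms (Imp A B) = insert (Imp A B) (subfms A \<union> subfms B)"
| "subfms (Box A) = insert (Box A) (subfms A)"

lemma finite_subfms: "finite (subfms A)"
  by (induction A) auto

lemma subfms_refl: "A \<in> subfms A"
  by (cases A) auto

lemma subfms_trans: "B \<in> subfms A \<Longrightarrow> subfms B \<subseteq> subfms A"
  by (induction A) auto

lemma subfms_closed: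
  "Neg B \<in> subfms A \<Longrightarrow> B \<in> subfms A"
  "And B C \<in> subfms A \<Longrightarrow> B \<in> subfms A \<and> C \<in> subfms A"
  "Or B C \<in> subfms A \<Longrightarrow> B \<in> subfms A \<and> C \<in> subfms A"
  "Imp B C \<in> subfms A \<Longrightarrow> B \<in> subfms A \<and> C \<in> subfms A"
  "Box B \<in> subfms A \<Longrightarrow> B \<in> subfms A"
  by (drule subfms_trans; use subfms_refl in auto)+

text \<open>\<open>ext W b B\<close> is the set of worlds that force \<open>B\<close>, and \<open>nbh W b B\<close> the set of worlds at which \<open>B\<close>
  is necessary. The set \<open>b x\<close> prescribes which variables hold and which boxed formulas are imposed
  at \<open>x\<close>; what else becomes necessary is only what (N) and (C) enforce.\<close>

function ext :: "'w set \<Rightarrow> ('w \<Rightarrow> fm set) \<Rightarrow> fm \<Rightarrow> 'w set"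
  and nbh :: "'w set \<Rightarrow> ('w \<Rightarrow> fm set) \<Rightarrow> fm \<Rightarrow> 'w set" where
  "ext W b (Var n) = {x \<in> W. Var n \<in> b x}"
| "ext W b Bot = {}"
| "ext W b (Neg A) = W - ext W b A"
| "ext W b (And A B) = ext W b A \<inter> ext W b B"
| "ext W b (Or A B) = ext W b A \<union> ext W b B"
| "ext W b (Imp A B) = (W - ext W b A) \<union> ext W b B"
| "ext W b (Box A) = nbh W b A"
| "nbh W b A = {x \<in> W. Box A \<in> b x} \<union> (if ext W b A = W then W else {}) \<union>
     (case A of And B C \<Rightarrow> nbh W b B \<inter> nbh W b C | _ \<Rightarrow> {})"
  by pat_completeness auto
termination
  by (relation "measure (\<lambda>p. case p of Inl (W, b, A) \<Rightarrow> 2 * size A | Inr (W, b, A) \<Rightarrow> 2 * size A + 1)")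
    auto

text \<open>The defining equation of \<^const>\<open>nbh\<close> applies to every argument and would unfold repeatedly.\<close>

declare nbh.simps [simp del]

lemma nbh_iff:
  "x \<in> nbh W b B \<longleftrightarrow> x \<in> W \<and> Box B \<in> b x \<or> x \<in> W \<and> ext W b B = W \<or>
     (\<exists>C D. B = And C D \<and> x \<in> nbh W b C \<and> x \<in> nbh W b D)"
  by (subst nbh.simps) (auto split: fm.split)

lemma ext_nbh_subset: "ext W b A \<subseteq> W \<and> nbh W b A \<subseteq> W"
  by (induction A) (auto simp: nbh.simps)

text \<open>The closure model with these truth sets. The closure operator is the identity, so the generators
  of a world are exactly its necessary formulas.\<close>

definition ext_model :: "'w set \<Rightarrow> ('w \<Rightarrow> fm set) \<Rightarrow> 'w model" where
  "ext_model W b = \<lparr>worlds = W, gens = (\<lambda>x. {B. x \<in> nbh W b B}), cl = id,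
     forces = (\<lambda>x B. x \<in> ext W b B)\<rparr>"

lemma closure_model_ext_model: "W \<noteq> {} \<Longrightarrow> closure_model (ext_model W b)"
  by (auto simp: closure_model_def ext_model_def closure_operator_def)

lemma valid_ext_model: "valid_in (ext_model W b) A \<longleftrightarrow> ext W b A = W"
  using ext_nbh_subset[of W b A] by (auto simp: valid_in_def ext_model_def)

lemma cond_N_ext_model: "cond_N (ext_model W b)"
  unfolding cond_N_def valid_ext_model by (auto simp: ext_model_def nbh.simps)

lemma cond_C_ext_model: "cond_C (ext_model W b)"
  unfolding cond_C_def by (auto simp: ext_model_def nbh.simps[of _ _ "And _ _"])

section \<open>The countermodel built from maximal consistent sets\<close>

text \<open>The worlds represent all traces of maximal consistent sets on the subformulas of \<open>A\<close>. Their type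
  is arbitrary; only the trace of a world matters.\<close>

locale filtration =
  fixes A :: fm and W :: "'w set" and b :: "'w \<Rightarrow> fm set"
  assumes worlds: "b ` W = {S \<inter> subfms A | S. mcs S}"
begin

lemma world_mcs:
  assumes "x \<in> W"
  obtains S where "mcs S" "b x = S \<inter> subfms A"
  using worlds assms by blast

lemma mcs_world:
  assumes "mcs S"
  obtains x where "x \<in> W" "b x = S \<inter> subfms A"
proof -
  have "S \<inter> subfms A \<in> b ` W"
    using worlds assms by blast
  then show thesis
    using that by blast
qed

lemma CND_if_valid:
  assumes truth: "\<And>S x. mcs S \<Longrightarrow> x \<in> W \<Longrightarrow> b x = S \<inter> subfms A \<Longrightarrow> x \<in> ext W b B \<Longrightarrow> B \<in> S"
    and "ext W b B = W"
  shows "B \<in> CND"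
  using assms by (metis Lindenbaum mcs_world)

text \<open>The second part bounds the formulas made necessary by (N) and (C): within the subformulas of \<open>A\<close>
  they are already necessary according to any maximal consistent set with the trace of the world. Both
  parts are proved by one induction, as the boxed case of the first rests on the second.\<close>

lemma truth_lemma:
  assumes "B \<in> subfms A"
  shows "\<And>S x. mcs S \<Longrightarrow> x \<in> W \<Longrightarrow> b x = S \<inter> subfms A \<Longrightarrow> (x \<in> ext W b B \<longleftrightarrow> B \<in> S)"
    and "\<And>S x. mcs S \<Longrightarrow> x \<in> W \<Longrightarrow> b x = S \<inter> subfms A \<Longrightarrow> x \<in> nbh W b B \<Longrightarrow> Box B \<in> S"
proof -
  let ?T = "\<lambda>B. \<forall>S x. mcs S \<longrightarrow> x \<in> W \<longrightarrow> b x = S \<inter> subfms A \<longrightarrow> (x \<in> ext W b B \<longleftrightarrow> B \<in> S)"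
  let ?N = "\<lambda>B. \<forall>S x. mcs S \<longrightarrow> x \<in> W \<longrightarrow> b x = S \<inter> subfms A \<longrightarrow> x \<in> nbh W b B \<longrightarrow> Box B \<in> S"
  have nec: "Box B \<in> S" if "?T B" "ext W b B = W" "mcs S" for B S
    using CND_if_valid[of B] that Nec_CND mcs_CND by blast
  have N: "?N B" if T: "?T B" and conj: "\<And>C D. B = And C D \<Longrightarrow> ?N C \<and> ?N D" for B
  proof (intro allI impI)
    fix S x assume S: "mcs S" and x: "x \<in> W" "b x = S \<inter> subfms A" and "x \<in> nbh W b B"
    then consider "Box B \<in> b x" | "ext W b B = W"
      | C D where "B = And C D" "x \<in> nbh W b C" "x \<in> nbh W b D"
      using nbh_iff[of x W b B] by blast
    then show "Box B \<in> S"
    proof cases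
      case 1
      then show ?thesis using x by blast
    next
      case 2
      then show ?thesis using nec T S by blast
    next
      case 3
      then have "Box C \<in> S" "Box D \<in> S"
        using conj S x by blast+
      then show ?thesis
        using 3(1) mcs_Box_And S by blast
    qed
  qed
  have "?T B \<and> ?N B"
    using assms
  proof (induction B)
    case (Var n)
    then have T: "?T (Var n)" by auto
    show ?case by (intro conjI T N[OF T]) auto
  next
    case Bot
    have T: "?T Bot" by (auto simp: mcs_Bot)
    show ?case by (intro conjI T N[OF T]) auto
  next
    case (Neg B)
    then have "?T B"
      using subfms_closed(1) by blast
    then have T: "?T (Neg B)" by (auto simp: mcs_Neg)
    show ?case by (intro conjI T N[OF T]) auto
  next
    case (And B C)
    then have IH: "?T B" "?N B" "?T C" "?N C"
      using subfms_closed(2) by blast+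
    have T: "?T (And B C)" using IH(1,3) by (auto simp: mcs_And)
    have "?N C' \<and> ?N D'" if eq: "And B C = And C' D'" for C' D'
    proof -
      have "C' = B" "D' = C" using eq by simp_all
      then show ?thesis using IH(2,4) by (simp only: simp_thms)
    qed
    then have "?N (And B C)" by (rule N[OF T])
    with T show ?case ..
  next
    case (Or B C)
    then have "?T B" "?T C"
      using subfms_closed(3) by blast+
    then have T: "?T (Or B C)" by (auto simp: mcs_Or)
    show ?case by (intro conjI T N[OF T]) auto
  next
    case (Imp B C)
    then have "?T B" "?T C"
      using subfms_closed(4) by blast+
    then have T: "?T (Imp B C)" by (auto simp: mcs_Imp)
    show ?case by (intro conjI T N[OF T]) auto
  next
    case (Box B)
    then have IH: "?N B"
      using subfms_closed(5) by blast
    have T: "?T (Box B)"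
    proof (intro allI impI)
      fix S x assume *: "mcs S" "x \<in> W" "b x = S \<inter> subfms A"
      have "x \<in> nbh W b B" if "Box B \<in> S"
        using * that Box.prems nbh_iff[of x W b B] by blast
      then show "x \<in> ext W b (Box B) \<longleftrightarrow> Box B \<in> S"
        using IH * by auto
    qed
    show ?case by (intro conjI T N[OF T]) auto
  qed
  then show "\<And>S x. mcs S \<Longrightarrow> x \<in> W \<Longrightarrow> b x = S \<inter> subfms A \<Longrightarrow> (x \<in> ext W b B \<longleftrightarrow> B \<in> S)"
    and "\<And>S x. mcs S \<Longrightarrow> x \<in> W \<Longrightarrow> b x = S \<inter> subfms A \<Longrightarrow> x \<in> nbh W b B \<Longrightarrow> Box B \<in> S"
    by blast+
qed

text \<open>Outside the subformulas of \<open>A\<close> there is no truth lemma, but a necessary formula \<open>B\<close> of a world is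
  still entailed by a formula \<open>E\<close> that is necessary in the maximal consistent set: \<open>E\<close> is \<open>B\<close> itself
  if \<open>Box B\<close> is imposed, verum if \<open>B\<close> is valid, and a conjunction of witnesses if \<open>B\<close> is a
  conjunction.\<close>

lemma nbh_witness:
  assumes "mcs S" "x \<in> W" "b x = S \<inter> subfms A" "x \<in> nbh W b B"
  shows "\<exists>E. Box E \<in> S \<and> (\<forall>T y. mcs T \<longrightarrow> y \<in> W \<longrightarrow> b y = T \<inter> subfms A \<longrightarrow> E \<in> T \<longrightarrow> y \<in> ext W b B)"
  using assms(4)
proof (induction B rule: measure_induct_rule[of size])
  case (less B)
  then consider (seed) "Box B \<in> b x" | (valid) "ext W b B = W"
    | (conj) C D where "B = And C D" "x \<in> nbh W b C" "x \<in> nbh W b D"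
    using nbh_iff[of x W b B] by blast
  then show ?case
  proof cases
    case seed
    then have "B \<in> subfms A"
      using assms(3) subfms_closed(5) by blast
    then show ?thesis
      using seed assms(3) truth_lemma(1) by blast
  next
    case valid
    have "Box (Neg Bot) \<in> S"
      by (rule mcs_CND[OF assms(1) Nec_CND[OF tautology_CND]]) (simp add: tautology_def)
    then show ?thesis
      using valid by blast
  next
    case conj
    have "size C < size B" "size D < size B"
      using conj(1) by simp_all
    then obtain E F where E: "Box E \<in> S"
        "\<And>T y. mcs T \<Longrightarrow> y \<in> W \<Longrightarrow> b y = T \<inter> subfms A \<Longrightarrow> E \<in> T \<Longrightarrow> y \<in> ext W b C"
      and F: "Box F \<in> S"
        "\<And>T y. mcs T \<Longrightarrow> y \<in> W \<Longrightarrow> b y = T \<inter> subfms A \<Longrightarrow> F \<in> T \<Longrightarrow> y \<in> ext W b D"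
      using less.IH[OF _ conj(2)] less.IH[OF _ conj(3)] by blast
    have "y \<in> ext W b B"
      if "mcs T" "y \<in> W" "b y = T \<inter> subfms A" "And E F \<in> T" for T y
      using E(2)[OF that(1-3)] F(2)[OF that(1-3)] that(4) mcs_And[OF that(1)] conj(1) by simp
    then show ?thesis
      using mcs_Box_And[OF assms(1) E(1) F(1)] by blast
  qed
qed

lemma cond_D_ext_model: "cond_D (ext_model W b)"
proof -
  have False if x: "x \<in> W" and nb: "x \<in> nbh W b B" "x \<in> nbh W b (Neg B)" for x B
  proof -
    obtain S where S: "mcs S" "b x = S \<inter> subfms A"
      using world_mcs[OF x] .
    obtain E F where EF: "Box E \<in> S" "Box F \<in> S"
      and E: "\<And>T y. mcs T \<Longrightarrow> y \<in> W \<Longrightarrow> b y = T \<inter> subfms A \<Longrightarrow> E \<in> T \<Longrightarrow> y \<in> ext W b B"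
      and F: "\<And>T y. mcs T \<Longrightarrow> y \<in> W \<Longrightarrow> b y = T \<inter> subfms A \<Longrightarrow> F \<in> T \<Longrightarrow> y \<in> ext W b (Neg B)"
      using nbh_witness[OF S(1) x S(2) nb(1)] nbh_witness[OF S(1) x S(2) nb(2)] by blast
    have "Neg (And E F) \<in> T" if T: "mcs T" for T
    proof -
      obtain y where "y \<in> W" "b y = T \<inter> subfms A"
        using mcs_world[OF T] .
      then have "\<not> (E \<in> T \<and> F \<in> T)"
        using E F T by fastforce
      then show ?thesis
        using T by (simp add: mcs_Neg mcs_And)
    qed
    then have "Neg (And E F) \<in> CND"
      by (metis Lindenbaum)
    then have "Box (Neg (And E F)) \<in> S"
      using Nec_CND mcs_CND S(1) by blast
    moreover have "Box (And E F) \<in> S"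
      using EF mcs_Box_And S(1) by blast
    ultimately show False
      using mcs_Box_consistent S(1) by blast
  qed
  then show ?thesis
    by (auto simp: cond_D_def ext_model_def)
qed

end


section \<open>The countermodel is primitive recursively presented\<close>

lemma finite_subfms_trace: "finite {S \<inter> subfms A | S. P S}"
  by (rule finite_subset[of _ "Pow (subfms A)"]) (auto simp: finite_subfms)

lemma nbh_outside:
  assumes "\<And>x. x \<in> W \<Longrightarrow> b x \<subseteq> subfms A" and "B \<notin> subfms A"
  shows "x \<in> nbh W b B \<longleftrightarrow> x \<in> W \<and> ext W b B = W \<or>
    (\<exists>C D. B = And C D \<and> x \<in> nbh W b C \<and> x \<in> nbh W b D)"
  using nbh_iff[of x W b B] assms subfms_closed(5) by blast

lemma prim_rec_presented_ext_model:
  fixes W :: "'w set"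
  assumes W: "finite W" and b: "\<And>x. x \<in> W \<Longrightarrow> b x \<subseteq> subfms A"
  shows "prim_rec_presented (ext_model W b)"
proof -
  obtain e :: "'w \<Rightarrow> nat" where e: "inj_on e W"
    using finite_imp_inj_to_nat_seg[OF W] by blast
  \<comment> \<open>Recording \<open>B\<close> itself when it is a subformula of \<open>A\<close> makes membership of compound formulas in the
    sets \<open>b x\<close> depend only on the states of their components.\<close>
  define st where "st B = (ext W b B, nbh W b B, if B \<in> subfms A then Some B else None)" for B
  have out: "x \<in> nbh W b B \<longleftrightarrow> x \<in> W \<and> ext W b B = W \<or>
      (\<exists>C D. B = And C D \<and> x \<in> nbh W b C \<and> x \<in> nbh W b D)"
    if "B \<notin> subfms A" for x B
    using nbh_outside[OF b that] .
  have st_iff: "st B = st B' \<longleftrightarrow> ext W b B = ext W b B' \<and> nbh W b B = nbh W b B' \<and>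
      (B = B' \<or> B \<notin> subfms A \<and> B' \<notin> subfms A)" for B B'
    by (auto simp: st_def)
  have "prim_rec_rel {(e x, fm_code B) | x B. x \<in> W \<and> x \<in> nbh W b B}"
  proof (rule prim_rec_rel_compositional[where st = st and c = "({}, {}, None)"])
    have "range st \<subseteq> Pow W \<times> Pow W \<times> insert None (Some ` subfms A)"
      using ext_nbh_subset by (fastforce simp: st_def)
    then show "finite (range st)"
      by (rule finite_subset) (simp add: W finite_subfms)
    have "st (Var i) = ({}, {}, None)" if "Var i \<notin> subfms A" for i
    proof -
      have "ext W b (Var i) = {}"
        using b that by auto
      moreover from this have "nbh W b (Var i) = {}"
        using out[OF that] by auto
      ultimately show ?thesis
        using that by (simp add: st_def)
    qed
    then have "{i. st (Var i) \<noteq> ({}, {}, None)} \<subseteq> Var -` subfms A"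
      by auto
    then show "finite {i. st (Var i) \<noteq> ({}, {}, None)}"
      by (rule finite_subset) (simp add: finite_vimageI finite_subfms inj_def)
  next
    fix B B' assume eq: "st B = st B'"
    show "st (Neg B) = st (Neg B') \<and> st (Box B) = st (Box B')"
    proof (cases "B = B'")
      case False
      then have notin: "Neg B \<notin> subfms A" "Neg B' \<notin> subfms A"
          "Box B \<notin> subfms A" "Box B' \<notin> subfms A"
        using eq subfms_closed(1,5) unfolding st_iff by blast+
      have "ext W b (Neg B) = ext W b (Neg B')" "ext W b (Box B) = ext W b (Box B')"
        using eq by (simp_all add: st_iff)
      then show ?thesis
        using notin by (simp add: st_iff set_eq_iff out)
    qed simp
  next
    fix B B' C C' assume eq: "st B = st B'" "st C = st C'"
    show "st (And B C) = st (And B' C') \<and> st (Or B C) = st (Or B' C') \<and>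
        st (Imp B C) = st (Imp B' C')"
    proof (cases "B = B' \<and> C = C'")
      case False
      then have notin: "And B C \<notin> subfms A" "And B' C' \<notin> subfms A"
          "Or B C \<notin> subfms A" "Or B' C' \<notin> subfms A"
          "Imp B C \<notin> subfms A" "Imp B' C' \<notin> subfms A"
        using eq subfms_closed(2-4) unfolding st_iff by blast+
      have "ext W b (And B C) = ext W b (And B' C')" "ext W b (Or B C) = ext W b (Or B' C')"
          "ext W b (Imp B C) = ext W b (Imp B' C')"
          "nbh W b B = nbh W b B'" "nbh W b C = nbh W b C'"
        using eq by (simp_all add: st_iff)
      then show ?thesis
        using notin by (simp add: st_iff set_eq_iff out)
    qed simp
  qed (use W in \<open>auto simp: st_iff\<close>)
  moreover have "prim_rec_rel {(e x, fm_code (Var i)) | x i. x \<in> W \<and> x \<in> ext W b (Var i)}"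
    (is "prim_rec_rel ?V")
  proof (rule prim_rec_rel_finite)
    have "?V \<subseteq> e ` W \<times> fm_code ` subfms A"
      using b by (fastforce simp del: fm_code.simps)
    then show "finite ?V"
      by (rule finite_subset) (simp add: W finite_subfms)
  qed
  moreover have "prim_rec_set (e ` W)"
    using W by (simp add: prim_rec_set_finite)
  ultimately show ?thesis
    using e unfolding prim_rec_presented_def ext_model_def
    by (intro exI[of _ e]) (simp del: ext.simps)
qed

section \<open>Completeness\<close>

lemma completeness:
  assumes "infinite (UNIV :: 'w set)" and "A \<notin> CND"
  obtains M :: "'w model" where "closure_model M" "prim_rec_presented M"
    "cond_N M" "cond_C M" "cond_D M" "\<not> valid_in M A"
proof -
  let ?X = "{S \<inter> subfms A | S. mcs S}"
  \<comment> \<open>Any infinite type has room for as many worlds as there are traces.\<close>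
  obtain W :: "'w set" where W: "finite W" "card W = card ?X"
    using infinite_arbitrarily_large[OF assms(1)] by blast
  then obtain b where "bij_betw b W ?X"
    using finite_same_card_bij finite_subfms_trace by blast
  then interpret filtration A W b
    by unfold_locales (rule bij_betw_imp_surj_on)
  obtain S where S: "mcs S" "A \<notin> S"
    using Lindenbaum[OF assms(2)] .
  obtain x where x: "x \<in> W" "b x = S \<inter> subfms A"
    using mcs_world[OF S(1)] .
  have "b y \<subseteq> subfms A" if "y \<in> W" for y
    using world_mcs[OF that] by blast
  then have "prim_rec_presented (ext_model W b)"
    by (rule prim_rec_presented_ext_model[OF W(1)])
  moreover have "closure_model (ext_model W b)"
    using x(1) by (intro closure_model_ext_model) blast
  moreover have "x \<notin> ext W b A"
    using truth_lemma(1)[OF subfms_refl S(1) x] S(2) by simp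
  then have "\<not> valid_in (ext_model W b) A"
    using x(1) unfolding valid_ext_model by blast
  ultimately show thesis
    using that cond_N_ext_model cond_C_ext_model cond_D_ext_model by blast
qed

theorem theorem3p29:
  fixes A :: fm
  assumes "infinite (UNIV :: 'w set)"
  shows "(A \<in> CND \<longleftrightarrow>
            (\<forall>M :: 'w model. closure_model M \<and> cond_N M \<and> cond_C M \<and> cond_D M
               \<longrightarrow> valid_in M A))
       \<and> (A \<in> CND \<longleftrightarrow>
            (\<forall>M :: 'w model. closure_model M \<and> prim_rec_presented M
               \<and> cond_N M \<and> cond_C M \<and> cond_D M
               \<longrightarrow> valid_in M A))"
proof -
  let ?N = "\<lambda>M :: 'w model. cond_N M \<and> cond_C M \<and> cond_D M"
  have "valid_in M A" if "A \<in> CND" "closure_model M" "?N M" for M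
    using soundness[OF that(1,2)] that(3) by blast
  moreover have "\<exists>M. closure_model M \<and> prim_rec_presented M \<and> ?N M \<and> \<not> valid_in M A"
    if "A \<notin> CND"
    using completeness[OF assms that] by blast
  ultimately show ?thesis
    by blast
qed

end
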